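(* Let $\rho:\mathbb{R}\to\mathbb{R}$ be convex, let $\lambda>0$, and let $y_i=\theta^*_i+\epsilon_i$, $1\le i\le n$, where $\theta^*\in\mathbb{R}^n$ is piecewise constant with $K$ pieces (see context) and $\epsilon_1,\dots,\epsilon_n$ are i.i.d. with distribution $D$. Assume that for some $\sigma>0$ the random variables $\rho'_+(\epsilon_i-t)$ and $\rho'_-(\epsilon_i-t)$ are sub-Gaussian with parameter $\sigma$ for every $t\in\mathbb{R}$. Let $\hat\theta$ be the generalized fused lasso estimator $$\hat\theta=\arg\min_{\theta\in\mathbb{R}^n}\ \sum_{i=1}^n\rho(y_i-\theta_i)+\lambda\sum_{i=1}^{n-1}|\theta_i-\theta_{i+1}|.$$ Fix any $i\in\{1,\dots,n\}$. Then for every $\delta\in(0,\tfrac{\log 2}{e})$: 1. $\Pr\big(L^+(\hat\theta_i-\theta^*_i)\le -B_{i,\delta}\big)\le\big(1+\tfrac{24}{(\log 2)^2}\big)\delta^2$; 2. $\Pr\big(L^-(\hat\theta_i-\theta^*_i)\ge B_{i,\delta}\big)\le\big(1+\tfrac{24}{(\log 2)^2}\big)\delta^2$, where $$B_{i,\delta}=4\sigma\left(\sqrt{\frac{\log\log(2\max(3,d_i))}{\max(3,d_i)}}+\sqrt{\frac{\log\frac1\delta}{d_i}}\right)+4\sigma^2\,\frac{\log\log(2m_{k(i)})+\log\frac1\delta}{\lambda}+\frac{2\sqrt{m_{k(i)}\sigma^2\log\frac1\delta}+2\lambda}{m_{k(i)}}.$$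
   Context: $\rho'_-$ and $\rho'_+$ denote the left and right derivatives of the convex function $\rho$. A random variable $X$ is sub-Gaussian with parameter $\sigma$ if $\mathbb{E}[e^{s(X-\mathbb{E}X)}]\le e^{\sigma^2s^2/2}$ for all $s\in\mathbb{R}$. Define $L^+(t)=\mathbb{E}_{\epsilon\sim D}\,\rho'_+(\epsilon-t)$ and $L^-(t)=\mathbb{E}_{\epsilon\sim D}\,\rho'_-(\epsilon-t)$ for $t\in\mathbb{R}$. $\theta^*$ is piecewise constant with $K$ pieces: there are integers $1=n_1<n_2<\cdots<n_K<n$, with the convention $n_{K+1}=n+1$, such that $\theta^*_{n_k}=\theta^*_{n_k+1}=\cdots=\theta^*_{n_{k+1}-1}$ for each $1\le k\le K$. The length of the $k$-th piece is $m_k=n_{k+1}-n_k$. For $i\in\{1,\dots,n\}$, $k(i)$ is the index of the piece containing $i$, i.e. $n_{k(i)}\le i\le n_{k(i)+1}-1$, and $d_i=\min(i+1-n_{k(i)},\,n_{k(i)+1}-i)$. $\arg\min$ denotes a minimizer; $\log$ is the natural logarithm. *)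

theory Defs
  imports "HOL-Probability.Probability"
begin

definition right_deriv :: "(real \<Rightarrow> real) \<Rightarrow> real \<Rightarrow> real" where
  "right_deriv f x = Lim (at_right 0) (\<lambda>h. (f (x + h) - f x) / h)"

definition left_deriv :: "(real \<Rightarrow> real) \<Rightarrow> real \<Rightarrow> real" where
  "left_deriv f x = Lim (at_left 0) (\<lambda>h. (f (x + h) - f x) / h)"

text \<open>
  The Bochner integral of a non-integrable function is 0, so integrability of \<open>X\<close> and of its
  exponential moments has to be demanded explicitly.
\<close>

definition sub_Gaussian :: "'a measure \<Rightarrow> ('a \<Rightarrow> real) \<Rightarrow> real \<Rightarrow> bool" where
  "sub_Gaussian M X \<sigma> \<longleftrightarrow>
     integrable M X \<and>
     (\<forall>s. integrable M (\<lambda>\<omega>. exp (s * (X \<omega> - (\<integral>\<omega>'. X \<omega>' \<partial>M)))) \<and>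
          (\<integral>\<omega>. exp (s * (X \<omega> - (\<integral>\<omega>'. X \<omega>' \<partial>M))) \<partial>M) \<le> exp (\<sigma>\<^sup>2 * s\<^sup>2 / 2))"

definition L_plus :: "(real \<Rightarrow> real) \<Rightarrow> real measure \<Rightarrow> real \<Rightarrow> real" where
  "L_plus \<rho> D t = (\<integral>x. right_deriv \<rho> (x - t) \<partial>D)"

definition L_minus :: "(real \<Rightarrow> real) \<Rightarrow> real measure \<Rightarrow> real \<Rightarrow> real" where
  "L_minus \<rho> D t = (\<integral>x. left_deriv \<rho> (x - t) \<partial>D)"

text \<open>
  Vectors of length \<open>n\<close> are functions on \<open>{1..n}\<close>. The pieces of \<open>\<theta>\<close> are the intervals
  \<open>{p k..<p (k + 1)}\<close> for \<open>1 \<le> k \<le> K\<close>. Neighbouring pieces may carry the same value.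
\<close>

definition piecewise_constant ::
    "nat \<Rightarrow> nat \<Rightarrow> (nat \<Rightarrow> nat) \<Rightarrow> (nat \<Rightarrow> real) \<Rightarrow> bool" where
  "piecewise_constant n K p \<theta> \<longleftrightarrow>
     1 \<le> K \<and> p 1 = 1 \<and> strict_mono_on {1..K} p \<and> p K < n \<and> p (K + 1) = n + 1 \<and>
     (\<forall>k\<in>{1..K}. \<forall>j\<in>{p k..<p (k + 1)}. \<theta> j = \<theta> (p k))"

definition piece_index :: "nat \<Rightarrow> (nat \<Rightarrow> nat) \<Rightarrow> nat \<Rightarrow> nat" where
  "piece_index K p i = (THE k. k \<in> {1..K} \<and> i \<in> {p k..<p (k + 1)})"

definition piece_length :: "(nat \<Rightarrow> nat) \<Rightarrow> nat \<Rightarrow> nat" where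
  "piece_length p k = p (k + 1) - p k"

definition boundary_dist :: "nat \<Rightarrow> (nat \<Rightarrow> nat) \<Rightarrow> nat \<Rightarrow> nat" where
  "boundary_dist K p i =
     min (i + 1 - p (piece_index K p i)) (p (piece_index K p i + 1) - i)"

definition fused_lasso_objective ::
    "(real \<Rightarrow> real) \<Rightarrow> real \<Rightarrow> nat \<Rightarrow> (nat \<Rightarrow> real) \<Rightarrow> (nat \<Rightarrow> real) \<Rightarrow> real" where
  "fused_lasso_objective \<rho> lam n y \<theta> =
     (\<Sum>i=1..n. \<rho> (y i - \<theta> i)) + lam * (\<Sum>i=1..n - 1. \<bar>\<theta> i - \<theta> (i + 1)\<bar>)"

definition error_bound :: "real \<Rightarrow> real \<Rightarrow> nat \<Rightarrow> nat \<Rightarrow> real \<Rightarrow> real" where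
  "error_bound \<sigma> lam d m \<delta> =
     4 * \<sigma> * (sqrt (ln (ln (2 * max 3 (real d))) / max 3 (real d)) + sqrt (ln (1 / \<delta>) / real d))
     + 4 * \<sigma>\<^sup>2 * ((ln (ln (2 * real m)) + ln (1 / \<delta>)) / lam)
     + (2 * sqrt (real m * \<sigma>\<^sup>2 * ln (1 / \<delta>)) + 2 * lam) / real m"

end

theory Submission
  imports Defs
begin

text \<open>
  Write \<open>t = \<theta>h i - \<theta>s i\<close> and let \<open>{s..e}\<close> be the piece of \<open>i\<close>. Lower the estimator slightly on the longest
  run \<open>{a..b}\<close> around \<open>i\<close> inside the piece on which it is at least \<open>\<theta>h i\<close>. The penalty decreases at each
  end of the run that lies strictly inside the piece, and increases by at most the same amount at an
  end of the piece. Optimality therefore forces the scores \<open>right_deriv \<rho> (\<epsilon> j - t)\<close> to have a sum over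
  \<open>{a..b}\<close> of at least \<open>2 * lam\<close>, \<open>0\<close> or \<open>-2 * lam\<close>, according to how many ends of the piece the run touches
  (\<open>fused_lasso_run_score\<close>).

  If the mean \<open>L_plus \<rho> D t\<close> of each score is at most \<open>- B\<close>, then the sum of the centred scores must
  exceed this level by \<open>B\<close> per term. That is a large deviation for some interval that contains \<open>i\<close>. The only
  probabilistic tool is the bound \<open>exp (- 2 * c * x / \<sigma>\<^sup>2)\<close> for the probability that partial sums of
  independent centred sub-Gaussian variables ever reach the line of slope \<open>c\<close> and intercept \<open>x\<close>
  (\<open>sub_Gaussian_linear_boundary\<close>). It follows from a maximal inequality for products of independent
  nonnegative variables with mean at most 1. Being uniform in the number of terms, it controls all
  intervals with a fixed end at once. Runs that touch the ends of the piece have a fixed end already,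
  and a run strictly inside is cut at \<open>i\<close>, sharing its \<open>2 * lam\<close> between both parts
  (\<open>interval_sum_excess_prob\<close>).

  The threshold \<open>t\<close> is random, but the scores decrease in \<open>t\<close>. So it suffices to treat fixed thresholds
  and to exhaust the half-line of thresholds with \<open>L_plus \<rho> D t \<le> - B\<close> from inside
  (\<open>score_deviation_prob\<close>). The second claim is the first one for the reflected problem, with loss
  \<open>\<lambda>u. \<rho> (- u)\<close>, noise \<open>- \<epsilon>\<close> and estimator \<open>- \<theta>h\<close>.
\<close>

section \<open>One-sided derivatives of convex functions\<close>

lemma difference_quotient_mono:
  fixes \<rho> :: "real \<Rightarrow> real"
  assumes "convex_on UNIV \<rho>" "h \<noteq> 0" "k \<noteq> 0" "h \<le> k"
  shows "(\<rho> (x + h) - \<rho> x) / h \<le> (\<rho> (x + k) - \<rho> x) / k"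
proof (cases "h = k")
  case False
  with assms have "h < k" by simp
  then consider "0 < h" "h < k" | "h < 0" "0 < k" | "h < k" "k < 0"
    using assms by linarith
  then show ?thesis
  proof cases
    case 1
    from convex_on_slope_le(1)[OF assms(1), of x "x + k" "x + h"] 1 show ?thesis
      by (simp add: field_simps)
  next
    case 2
    from convex_on_slope_le[OF assms(1), of "x + h" "x + k" x] 2 show ?thesis
      by (simp add: field_simps)
  next
    case 3
    from convex_on_slope_le(2)[OF assms(1), of "x + h" x "x + k"] 3 show ?thesis
      by (simp add: field_simps)
  qed
qed simp

text \<open>
  The difference quotient at \<open>x\<close> increases with the step, so as the step decreases to 0 the quotient
  decreases; the quotient of any negative step, here \<open>-1\<close>, bounds it from below.
\<close>

lemma right_deriv_tendsto:
  fixes \<rho> :: "real \<Rightarrow> real"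
  assumes "convex_on UNIV \<rho>"
  shows "((\<lambda>h. (\<rho> (x + h) - \<rho> x) / h) \<longlongrightarrow> right_deriv \<rho> x) (at_right 0)"
proof -
  let ?q = "\<lambda>h. (\<rho> (x + h) - \<rho> x) / h"
  have "(?q \<longlongrightarrow> Inf (?q ` ({0<..} \<inter> UNIV))) (at 0 within ({0<..} \<inter> UNIV))"
  proof (rule Lim_right_bound)
    show "?q a \<le> ?q b" if "0 < a" "a \<le> b" for a b
      using difference_quotient_mono[OF assms, of a b x] that by simp
    show "?q (-1) \<le> ?q a" if "0 < a" for a
      using difference_quotient_mono[OF assms, of "-1" a x] that by simp
  qed
  then have "(?q \<longlongrightarrow> Inf (?q ` {0<..})) (at_right 0)"
    by simp
  with tendsto_Lim[OF trivial_limit_at_right_real this] show ?thesis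
    unfolding right_deriv_def by simp
qed

lemma right_deriv_mono:
  assumes "convex_on UNIV \<rho>"
  shows "mono (right_deriv \<rho>)"
proof (rule monoI)
  fix x y :: real
  assume "x \<le> y"
  show "right_deriv \<rho> x \<le> right_deriv \<rho> y"
  proof (cases "x = y")
    case False
    with \<open>x \<le> y\<close> have "x < y" by simp
    let ?s = "(\<rho> y - \<rho> x) / (y - x)"
    have "right_deriv \<rho> x \<le> ?s"
    proof (rule tendsto_upperbound[OF right_deriv_tendsto[OF assms]])
      have "\<forall>\<^sub>F h in at_right 0. h < y - x"
        using \<open>x < y\<close> by (intro order_tendstoD(2)[OF tendsto_ident_at]) simp
      then show "\<forall>\<^sub>F h in at_right 0. (\<rho> (x + h) - \<rho> x) / h \<le> ?s"
        using eventually_at_right_less[of 0]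
      proof eventually_elim
        case (elim h)
        then show ?case
          using difference_quotient_mono[OF assms, of h "y - x" x] by simp
      qed
    qed simp
    also have "?s \<le> right_deriv \<rho> y"
    proof (rule tendsto_lowerbound[OF right_deriv_tendsto[OF assms]])
      show "\<forall>\<^sub>F h in at_right 0. ?s \<le> (\<rho> (y + h) - \<rho> y) / h"
        using eventually_at_right_less[of 0]
      proof eventually_elim
        case (elim h)
        then show ?case
          using difference_quotient_mono[OF assms, of "x - y" h y] \<open>x < y\<close>
          by (simp add: field_simps)
      qed
    qed simp
    finally show ?thesis .
  qed simp
qed

lemma convex_on_reflect:
  fixes \<rho> :: "real \<Rightarrow> real"
  assumes "convex_on UNIV \<rho>"
  shows "convex_on UNIV (\<lambda>u. \<rho> (- u))"
proof (rule convex_onI)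
  fix t x y :: real
  assume "0 < t" "t < 1"
  then show "\<rho> (- ((1 - t) *\<^sub>R x + t *\<^sub>R y)) \<le> (1 - t) * \<rho> (- x) + t * \<rho> (- y)"
    using convex_onD[OF assms, of t "- x" "- y"] by simp
qed simp

text \<open>
  Reflection exchanges the two one-sided derivatives. It reduces the claim about \<open>L_minus\<close> to the
  claim about \<open>L_plus\<close> for the loss \<open>\<lambda>u. \<rho> (- u)\<close> and the noise \<open>- \<epsilon>\<close>.
\<close>

lemma left_deriv_reflect:
  assumes "convex_on UNIV \<rho>"
  shows "left_deriv \<rho> x = - right_deriv (\<lambda>u. \<rho> (- u)) (- x)"
proof -
  have "convex_on UNIV (\<lambda>u. \<rho> (- u))"
    by (rule convex_on_reflect[OF assms])
  from tendsto_minus[OF right_deriv_tendsto[OF this, of "- x"]]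
  have "((\<lambda>h. (\<rho> (x + h) - \<rho> x) / h) \<longlongrightarrow> - right_deriv (\<lambda>u. \<rho> (- u)) (- x)) (at_left 0)"
    unfolding at_left_minus[of 0] filterlim_filtermap by simp
  then show ?thesis
    unfolding left_deriv_def by (intro tendsto_Lim) auto
qed

section \<open>First-order condition on a run of the estimator\<close>

text \<open>
  This is where the penalty enters. Let \<open>{a..b}\<close> be the longest interval in \<open>{s..e}\<close> that contains \<open>i\<close>
  and on which \<open>\<theta>\<close> is at least \<open>\<theta> i\<close>, and lower \<open>\<theta>\<close> on it by a small \<open>h > 0\<close>. An endpoint strictly
  inside \<open>{s..e}\<close> borders on a smaller value, so the jump there shrinks by \<open>h\<close>; an endpoint of \<open>{s..e}\<close>
  costs at most \<open>h\<close>. Since \<open>\<theta>\<close> is a minimizer, the derivative of the objective in this direction is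
  nonnegative, which is the claimed inequality.
\<close>

lemma fused_lasso_run_score:
  fixes \<rho> :: "real \<Rightarrow> real" and \<theta> y :: "nat \<Rightarrow> real"
  assumes conv: "convex_on UNIV \<rho>" and lam: "0 \<le> lam"
    and min: "\<And>\<theta>'. fused_lasso_objective \<rho> lam n y \<theta> \<le> fused_lasso_objective \<rho> lam n y \<theta>'"
    and bounds: "1 \<le> s" "s \<le> i" "i \<le> e" "e \<le> n"
  obtains a b where "a \<in> {s..i}" "b \<in> {i..e}" "\<And>j. j \<in> {a..b} \<Longrightarrow> \<theta> i \<le> \<theta> j"
    "lam * ((if a = s then -1 else 1) + (if b = e then -1 else 1))
       \<le> (\<Sum>j=a..b. right_deriv \<rho> (y j - \<theta> j))"
proof -
  define P where "P a \<longleftrightarrow> s \<le> a \<and> a \<le> i \<and> (\<forall>j\<in>{a..i}. \<theta> i \<le> \<theta> j)" for a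
  define Q where "Q b \<longleftrightarrow> i \<le> b \<and> b \<le> e \<and> (\<forall>j\<in>{i..b}. \<theta> i \<le> \<theta> j)" for b
  define a where "a = (LEAST a. P a)"
  define b where "b = (GREATEST b. Q b)"
  have "P i" "Q i"
    using bounds by (auto simp: P_def Q_def)
  have Q_le: "b \<le> e" if "Q b" for b
    using that by (simp add: Q_def)
  have "P a"
    unfolding a_def by (rule LeastI[of P, OF \<open>P i\<close>])
  then have a: "s \<le> a" "a \<le> i" "\<forall>j\<in>{a..i}. \<theta> i \<le> \<theta> j"
    unfolding P_def by auto
  have "Q b"
    unfolding b_def by (rule GreatestI_nat[of Q, OF \<open>Q i\<close> Q_le])
  then have b: "i \<le> b" "b \<le> e" "\<forall>j\<in>{i..b}. \<theta> i \<le> \<theta> j"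
    unfolding Q_def by auto
  have run: "\<theta> i \<le> \<theta> j" if "j \<in> {a..b}" for j
    using a b that by (cases "j \<le> i") auto
  have left_drop: "\<theta> (a - 1) < \<theta> a" if "a \<noteq> s"
  proof -
    have "\<theta> (a - 1) < \<theta> i"
    proof (rule ccontr)
      assume "\<not> \<theta> (a - 1) < \<theta> i"
      have "{a - 1..i} = insert (a - 1) {a..i}"
        using a that by auto
      then have "P (a - 1)"
        using a that \<open>\<not> \<theta> (a - 1) < \<theta> i\<close> by (auto simp: P_def)
      then have "a \<le> a - 1"
        unfolding a_def by (rule Least_le)
      with bounds a that show False by auto
    qed
    also have "\<dots> \<le> \<theta> a" using run a b by auto
    finally show ?thesis .
  qed
  have right_drop: "\<theta> (b + 1) < \<theta> b" if "b \<noteq> e"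
  proof -
    have "\<theta> (b + 1) < \<theta> i"
    proof (rule ccontr)
      assume "\<not> \<theta> (b + 1) < \<theta> i"
      have "{i..b + 1} = insert (b + 1) {i..b}"
        using b that by auto
      then have "Q (b + 1)"
        using b that \<open>\<not> \<theta> (b + 1) < \<theta> i\<close> by (auto simp: Q_def)
      then have "b + 1 \<le> b"
        unfolding b_def by (rule Greatest_le_nat[of Q, OF _ Q_le])
      then show False by simp
    qed
    also have "\<dots> \<le> \<theta> b" using run a b by auto
    finally show ?thesis .
  qed
  \<comment> \<open>\<open>h * ca\<close> and \<open>h * cb\<close> bound the change of the jump to the left of \<open>a\<close> and to the
      right of \<open>b\<close>. They are valid for \<open>h < h0\<close>, when lowering \<open>\<theta>\<close> does not overshoot the neighbours.\<close>
  define ca cb :: real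
    where "ca = (if a = s then 1 else - 1)" and "cb = (if b = e then 1 else - 1)"
  define h0 where "h0 = min (if a = s then 1 else \<theta> a - \<theta> (a - 1)) (if b = e then 1 else \<theta> b - \<theta> (b + 1))"
  have "0 < h0"
    using left_drop right_drop unfolding h0_def by auto
  have quotient_ge: "- lam * (ca + cb) \<le> (\<Sum>j=a..b. (\<rho> (y j - \<theta> j + h) - \<rho> (y j - \<theta> j)) / h)"
    if h: "0 < h" "h < h0" for h
  proof -
    define \<theta>' where "\<theta>' j = (if j \<in> {a..b} then \<theta> j - h else \<theta> j)" for j
    have tv_step: "\<bar>\<theta>' j - \<theta>' (j + 1)\<bar> - \<bar>\<theta> j - \<theta> (j + 1)\<bar>
        \<le> (if j + 1 = a then h * ca else 0) + (if j = b then h * cb else 0)" for j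
    proof -
      consider "j + 1 = a" | "j = b" | "j + 1 \<noteq> a" "j \<noteq> b" by blast
      then show ?thesis
      proof cases
        case 1
        then have "\<theta>' j = \<theta> j" "\<theta>' (j + 1) = \<theta> a - h" "j \<noteq> b"
          using a b by (auto simp: \<theta>'_def)
        moreover have "h < \<theta> a - \<theta> j" if "a \<noteq> s"
          using h that 1 unfolding h0_def by auto
        ultimately show ?thesis
          using 1 h by (auto simp: ca_def)
      next
        case 2
        then have "\<theta>' j = \<theta> b - h" "\<theta>' (j + 1) = \<theta> (b + 1)" "j + 1 \<noteq> a"
          using a b by (auto simp: \<theta>'_def)
        moreover have "h < \<theta> b - \<theta> (b + 1)" if "b \<noteq> e"
          using h that unfolding h0_def by auto
        ultimately show ?thesis
          using 2 h by (auto simp: cb_def)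
      next
        case 3
        then have "j \<in> {a..b} \<longleftrightarrow> j + 1 \<in> {a..b}"
          by auto
        with 3 show ?thesis
          by (auto simp: \<theta>'_def)
      qed
    qed
    have "(\<Sum>j=1..n-1. \<bar>\<theta>' j - \<theta>' (j + 1)\<bar>) - (\<Sum>j=1..n-1. \<bar>\<theta> j - \<theta> (j + 1)\<bar>)
        \<le> (\<Sum>j=1..n-1. (if j + 1 = a then h * ca else 0) + (if j = b then h * cb else 0))"
      unfolding sum_subtractf[symmetric] by (intro sum_mono tv_step)
    \<comment> \<open>If \<open>a = 1\<close> there is no jump to the left of \<open>a\<close>, and \<open>a - 1 = 0\<close> lies outside the
        range of summation.\<close>
    also have "\<dots> = (\<Sum>j=1..n-1. if j = a - 1 then (if a = 1 then 0 else h * ca) else 0)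
        + (\<Sum>j=1..n-1. if j = b then h * cb else 0)"
      unfolding sum.distrib using a bounds by (intro arg_cong2[where f = "(+)"] sum.cong) auto
    also have "\<dots> \<le> h * ca + h * cb"
      using h a b bounds by (intro add_mono) (auto simp: sum.delta ca_def cb_def)
    finally have tv: "(\<Sum>j=1..n-1. \<bar>\<theta>' j - \<theta>' (j + 1)\<bar>)
        \<le> (\<Sum>j=1..n-1. \<bar>\<theta> j - \<theta> (j + 1)\<bar>) + h * (ca + cb)"
      by (simp add: algebra_simps)
    have "(\<Sum>j=1..n. \<rho> (y j - \<theta>' j)) - (\<Sum>j=1..n. \<rho> (y j - \<theta> j))
        = (\<Sum>j=1..n. \<rho> (y j - \<theta>' j) - \<rho> (y j - \<theta> j))"
      by (simp add: sum_subtractf)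
    also have "\<dots> = (\<Sum>j=a..b. \<rho> (y j - \<theta> j + h) - \<rho> (y j - \<theta> j))"
      using a b bounds by (intro sum.mono_neutral_cong_right) (auto simp: \<theta>'_def algebra_simps)
    finally have loss: "(\<Sum>j=1..n. \<rho> (y j - \<theta>' j)) - (\<Sum>j=1..n. \<rho> (y j - \<theta> j))
        = (\<Sum>j=a..b. \<rho> (y j - \<theta> j + h) - \<rho> (y j - \<theta> j))" .
    have "0 \<le> (\<Sum>j=a..b. \<rho> (y j - \<theta> j + h) - \<rho> (y j - \<theta> j)) + lam * (h * (ca + cb))"
      using min[of \<theta>'] loss mult_left_mono[OF tv lam]
      unfolding fused_lasso_objective_def by (simp add: algebra_simps)
    then have "- lam * (ca + cb) * h \<le> (\<Sum>j=a..b. \<rho> (y j - \<theta> j + h) - \<rho> (y j - \<theta> j))"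
      by (simp add: algebra_simps)
    then show ?thesis
      unfolding sum_divide_distrib[symmetric] using h(1) by (simp add: pos_le_divide_eq)
  qed
  have "- lam * (ca + cb) \<le> (\<Sum>j=a..b. right_deriv \<rho> (y j - \<theta> j))"
  proof (rule tendsto_lowerbound)
    show "((\<lambda>h. \<Sum>j=a..b. (\<rho> (y j - \<theta> j + h) - \<rho> (y j - \<theta> j)) / h)
        \<longlongrightarrow> (\<Sum>j=a..b. right_deriv \<rho> (y j - \<theta> j))) (at_right 0)"
      by (intro tendsto_sum right_deriv_tendsto conv)
    show "\<forall>\<^sub>F h in at_right 0. - lam * (ca + cb)
        \<le> (\<Sum>j=a..b. (\<rho> (y j - \<theta> j + h) - \<rho> (y j - \<theta> j)) / h)"
      using eventually_at_right_real[OF \<open>0 < h0\<close>]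
      by eventually_elim (use quotient_ge in auto)
  qed simp
  also have "- lam * (ca + cb)
      = lam * ((if a = s then -1 else 1) + (if b = e then -1 else 1))"
    by (simp add: ca_def cb_def)
  finally show ?thesis
    using a b run by (intro that[of a b]) auto
qed

section \<open>Maximal inequality for partial products\<close>

text \<open>
  The partial products of \<open>f\<close>, frozen as soon as they reach the level \<open>u\<close>. Stopping turns the event
  that some partial product reaches \<open>u\<close> into an event about the final value alone.
\<close>

primrec stopped_product :: "real \<Rightarrow> (nat \<Rightarrow> real) \<Rightarrow> nat \<Rightarrow> real" where
  "stopped_product u f 0 = 1"
| "stopped_product u f (Suc k) =
     (if u \<le> stopped_product u f k then stopped_product u f k
      else stopped_product u f k * f (Suc k))"

lemma stopped_product_nonneg:
  "(\<And>j. j \<in> {1..k} \<Longrightarrow> 0 \<le> f j) \<Longrightarrow> 0 \<le> stopped_product u f k"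
  by (induction k) auto

lemma stopped_product_cong:
  "(\<And>j. j \<in> {1..k} \<Longrightarrow> f j = g j) \<Longrightarrow> stopped_product u f k = stopped_product u g k"
  by (induction k) auto

lemma stopped_product_crossed:
  assumes "l \<le> k" "u \<le> (\<Prod>j=1..l. f j)"
  shows "u \<le> stopped_product u f k"
proof -
  have "u \<le> stopped_product u f k \<or>
      stopped_product u f k = (\<Prod>j=1..k. f j) \<and> (\<forall>l\<le>k. (\<Prod>j=1..l. f j) < u)"
    by (induction k) (auto simp: le_Suc_eq)
  with assms show ?thesis by auto
qed

lemma measurable_stopped_product:
  "h ` {1..k} \<subseteq> I \<Longrightarrow>
     (\<lambda>g. stopped_product u (\<lambda>j. g (h j)) k) \<in> borel_measurable (\<Pi>\<^sub>M i\<in>I. borel)"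
proof (induction k)
  case (Suc k)
  have [measurable]: "(\<lambda>g. stopped_product u (\<lambda>j. g (h j)) k) \<in> borel_measurable (\<Pi>\<^sub>M i\<in>I. borel)"
    using Suc by (auto simp: image_subset_iff)
  have [measurable]: "(\<lambda>g. g (h (Suc k))) \<in> borel_measurable (\<Pi>\<^sub>M i\<in>I. borel)"
    using Suc.prems by (intro measurable_component_singleton) auto
  show ?case by simp
qed simp

text \<open>
  The stopped products form a supermartingale. The part \<open>V\<close> of the current value \<open>W\<close> that is still
  running depends on the first \<open>k\<close> factors only, so it is independent of the next factor, and
  multiplying it by a factor of mean at most 1 does not increase its mean. The enumeration \<open>h\<close> allows
  the factors to be taken in any order.
\<close>

lemma (in prob_space) expectation_stopped_product_le_1:
  fixes Y :: "'i \<Rightarrow> 'a \<Rightarrow> real" and h :: "nat \<Rightarrow> 'i"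
  assumes indep: "indep_vars (\<lambda>_. borel) Y (h ` {1..N})" and inj: "inj_on h {1..N}"
    and int: "\<And>j. j \<in> {1..N} \<Longrightarrow> integrable M (Y (h j))"
    and nonneg: "\<And>j \<omega>. j \<in> {1..N} \<Longrightarrow> 0 \<le> Y (h j) \<omega>"
    and mean: "\<And>j. j \<in> {1..N} \<Longrightarrow> expectation (Y (h j)) \<le> 1"
    and "k \<le> N"
  shows "integrable M (\<lambda>\<omega>. stopped_product u (\<lambda>j. Y (h j) \<omega>) k) \<and>
    expectation (\<lambda>\<omega>. stopped_product u (\<lambda>j. Y (h j) \<omega>) k) \<le> 1"
  using \<open>k \<le> N\<close>
proof (induction k)
  case 0
  then show ?case by (simp add: prob_space)
next
  case (Suc k)
  define W where "W \<omega> = stopped_product u (\<lambda>j. Y (h j) \<omega>) k" for \<omega>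
  define V where "V \<omega> = (if u \<le> W \<omega> then 0 else W \<omega>)" for \<omega>
  have W: "integrable M W" "expectation W \<le> 1"
    using Suc by (simp_all add: W_def[abs_def])
  have [measurable]: "random_variable borel W"
    using W(1) by (rule borel_measurable_integrable)
  have W_nonneg: "0 \<le> W \<omega>" for \<omega>
    unfolding W_def using nonneg Suc.prems by (intro stopped_product_nonneg) auto
  have [measurable]: "random_variable borel V"
    unfolding V_def[abs_def] by measurable
  have V_int: "integrable M V"
    using W(1) by (rule Bochner_Integration.integrable_bound) (auto simp: V_def)
  let ?W = "\<lambda>g. stopped_product u (\<lambda>j. g (h j)) k" and ?V = "\<lambda>w::real. if u \<le> w then 0 else w"
  have "indep_var borel ((\<lambda>g. ?V (?W g)) \<circ> (\<lambda>\<omega>. restrict (\<lambda>i. Y i \<omega>) (h ` {1..k})))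
      borel ((\<lambda>g. g (h (Suc k))) \<circ> (\<lambda>\<omega>. restrict (\<lambda>i. Y i \<omega>) {h (Suc k)}))"
  proof (rule indep_var_compose[OF indep_var_restrict[OF indep]])
    show "h ` {1..k} \<inter> {h (Suc k)} = {}"
      using inj Suc.prems by (force dest: inj_onD)
    note [measurable] = measurable_stopped_product[OF order_refl, where h = h and k = k and u = u]
    show "(\<lambda>g. ?V (?W g)) \<in> borel_measurable (\<Pi>\<^sub>M i\<in>h ` {1..k}. borel)"
      by measurable
  qed (use Suc.prems in auto)
  moreover have "?W (restrict (\<lambda>i. Y i \<omega>) (h ` {1..k})) = W \<omega>" for \<omega>
    unfolding W_def by (rule stopped_product_cong) auto
  then have "(\<lambda>g. ?V (?W g)) \<circ> (\<lambda>\<omega>. restrict (\<lambda>i. Y i \<omega>) (h ` {1..k})) = V"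
    by (simp only: comp_def V_def[abs_def])
  moreover have "(\<lambda>g. g (h (Suc k))) \<circ> (\<lambda>\<omega>. restrict (\<lambda>i. Y i \<omega>) {h (Suc k)}) = Y (h (Suc k))"
    by (simp add: comp_def)
  ultimately have indep_step: "indep_var borel V borel (Y (h (Suc k)))"
    by (simp only:)
  have split: "stopped_product u (\<lambda>j. Y (h j) \<omega>) (Suc k) = (W \<omega> - V \<omega>) + V \<omega> * Y (h (Suc k)) \<omega>" for \<omega>
    by (simp add: W_def V_def)
  have int_next: "integrable M (Y (h (Suc k)))" and mean_next: "expectation (Y (h (Suc k))) \<le> 1"
    using int mean Suc.prems by auto
  note prod_int = indep_var_integrable[OF indep_step V_int int_next]
  have "expectation (\<lambda>\<omega>. (W \<omega> - V \<omega>) + V \<omega> * Y (h (Suc k)) \<omega>)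
      = expectation W - expectation V + expectation V * expectation (Y (h (Suc k)))"
    using W(1) V_int prod_int
    by (simp add: indep_var_lebesgue_integral[OF indep_step V_int int_next])
  also have "\<dots> \<le> expectation W"
  proof -
    have "0 \<le> expectation V"
      by (rule integral_nonneg_AE) (simp add: V_def W_nonneg)
    from mult_left_mono[OF mean_next this] show ?thesis by simp
  qed
  finally show ?case
    unfolding split using W V_int prod_int by simp
qed

text \<open>
  Ville's inequality on a finite horizon, by Markov's inequality for the stopped product.
\<close>

lemma (in prob_space) partial_product_maximal_inequality:
  fixes Y :: "'i \<Rightarrow> 'a \<Rightarrow> real" and h :: "nat \<Rightarrow> 'i"
  assumes indep: "indep_vars (\<lambda>_. borel) Y (h ` {1..N})" and inj: "inj_on h {1..N}"
    and int: "\<And>j. j \<in> {1..N} \<Longrightarrow> integrable M (Y (h j))"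
    and nonneg: "\<And>j \<omega>. j \<in> {1..N} \<Longrightarrow> 0 \<le> Y (h j) \<omega>"
    and mean: "\<And>j. j \<in> {1..N} \<Longrightarrow> expectation (Y (h j)) \<le> 1"
    and "0 < u"
  shows "prob {\<omega> \<in> space M. \<exists>k\<in>{1..N}. u \<le> (\<Prod>j=1..k. Y (h j) \<omega>)} \<le> 1 / u"
proof -
  define W where "W \<omega> = stopped_product u (\<lambda>j. Y (h j) \<omega>) N" for \<omega>
  have W: "integrable M W" "expectation W \<le> 1"
    using expectation_stopped_product_le_1[OF indep inj int nonneg mean order_refl, of u]
    by (simp_all add: W_def[abs_def])
  have [measurable]: "random_variable borel W"
    using W(1) by (rule borel_measurable_integrable)
  have "prob {\<omega> \<in> space M. \<exists>k\<in>{1..N}. u \<le> (\<Prod>j=1..k. Y (h j) \<omega>)} \<le> prob {\<omega> \<in> space M. u \<le> W \<omega>}"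
  proof (rule finite_measure_mono)
    show "{\<omega> \<in> space M. u \<le> W \<omega>} \<in> events"
      by measurable
  qed (auto simp: W_def intro: stopped_product_crossed)
  also have "\<dots> \<le> expectation W / u"
    using nonneg \<open>0 < u\<close>
    by (intro integral_Markov_inequality_measure[OF W(1), of "space M"])
       (auto simp: W_def intro!: stopped_product_nonneg)
  also have "\<dots> \<le> 1 / u"
    using W(2) \<open>0 < u\<close> by (simp add: divide_right_mono)
  finally show ?thesis .
qed

section \<open>Line crossing of sub-Gaussian sums\<close>

text \<open>
  Partial sums of centred sub-Gaussian variables rarely cross a line of positive slope, uniformly over
  the number of terms. The tilted variables \<open>exp (s * (X i - c))\<close> have mean at most
  \<open>exp (\<sigma>\<^sup>2 * s\<^sup>2 / 2 - s * c)\<close>, which is 1 for \<open>s = 2 * c / \<sigma>\<^sup>2\<close>, the largest exponent for which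
  the maximal inequality applies. Reaching the line means that their product is at least \<open>exp (s * x)\<close>.
\<close>

lemma (in prob_space) sub_Gaussian_linear_boundary:
  fixes X :: "'i \<Rightarrow> 'a \<Rightarrow> real" and h :: "nat \<Rightarrow> 'i"
  assumes indep: "indep_vars (\<lambda>_. borel) X (h ` {1..N})" and inj: "inj_on h {1..N}"
    and subg: "\<And>j. j \<in> {1..N} \<Longrightarrow> sub_Gaussian M (X (h j)) \<sigma>"
    and mean: "\<And>j. j \<in> {1..N} \<Longrightarrow> expectation (X (h j)) = 0"
    and "0 < \<sigma>" "0 \<le> c"
  shows "prob {\<omega> \<in> space M. \<exists>k\<in>{1..N}. c * real k + x \<le> (\<Sum>j=1..k. X (h j) \<omega>)}
    \<le> exp (- (2 * c * x / \<sigma>\<^sup>2))"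
proof -
  define s where "s = 2 * c / \<sigma>\<^sup>2"
  define Y where "Y i \<omega> = exp (s * (X i \<omega> - c))" for i \<omega>
  have "0 \<le> s"
    using \<open>0 \<le> c\<close> by (simp add: s_def)
  have Y_eq: "Y i = (\<lambda>\<omega>. exp (- (s * c)) * exp (s * X i \<omega>))" for i
    by (simp add: Y_def fun_eq_iff exp_add[symmetric] algebra_simps)
  have mgf: "integrable M (\<lambda>\<omega>. exp (s * X (h j) \<omega>))"
      "expectation (\<lambda>\<omega>. exp (s * X (h j) \<omega>)) \<le> exp (\<sigma>\<^sup>2 * s\<^sup>2 / 2)" if "j \<in> {1..N}" for j
    using subg[OF that] mean[OF that] unfolding sub_Gaussian_def by simp_all
  have variance_proxy: "\<sigma>\<^sup>2 * s\<^sup>2 / 2 = s * c"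
    using \<open>0 < \<sigma>\<close> by (simp add: s_def power2_eq_square)
  have Y_mean: "expectation (Y (h j)) \<le> 1" if "j \<in> {1..N}" for j
    using mult_left_mono[OF mgf(2)[OF that], of "exp (- (s * c))"]
    unfolding Y_eq variance_proxy by (simp add: exp_minus)
  have "{\<omega> \<in> space M. \<exists>k\<in>{1..N}. c * real k + x \<le> (\<Sum>j=1..k. X (h j) \<omega>)}
      \<subseteq> {\<omega> \<in> space M. \<exists>k\<in>{1..N}. exp (s * x) \<le> (\<Prod>j=1..k. Y (h j) \<omega>)}"
  proof safe
    fix \<omega> k
    assume "k \<in> {1..N}" and "c * real k + x \<le> (\<Sum>j=1..k. X (h j) \<omega>)"
    then have "s * x \<le> s * ((\<Sum>j=1..k. X (h j) \<omega>) - c * real k)"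
      using \<open>0 \<le> s\<close> by (intro mult_left_mono) auto
    also have "\<dots> = (\<Sum>j=1..k. s * (X (h j) \<omega> - c))"
      by (simp add: sum_distrib_left[symmetric] sum_subtractf mult.commute)
    finally have "exp (s * x) \<le> (\<Prod>j=1..k. Y (h j) \<omega>)"
      by (simp add: Y_def exp_sum[symmetric])
    with \<open>k \<in> {1..N}\<close> show "\<exists>k\<in>{1..N}. exp (s * x) \<le> (\<Prod>j=1..k. Y (h j) \<omega>)"
      by blast
  qed
  moreover have Y_indep: "indep_vars (\<lambda>_. borel) Y (h ` {1..N})"
    unfolding Y_def[abs_def] by (rule indep_vars_compose2[OF indep]) measurable
  moreover have Y_meas: "random_variable borel (Y (h j))" if "j \<in> {1..N}" for j
    using Y_indep that unfolding indep_vars_def2 by auto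
  have "{\<omega> \<in> space M. \<exists>k\<in>{1..N}. exp (s * x) \<le> (\<Prod>j=1..k. Y (h j) \<omega>)} \<in> events"
    by (intro sets.sets_Collect_finite_Ex borel_measurable_le borel_measurable_prod
          borel_measurable_const Y_meas) auto
  ultimately have "prob {\<omega> \<in> space M. \<exists>k\<in>{1..N}. c * real k + x \<le> (\<Sum>j=1..k. X (h j) \<omega>)}
      \<le> prob {\<omega> \<in> space M. \<exists>k\<in>{1..N}. exp (s * x) \<le> (\<Prod>j=1..k. Y (h j) \<omega>)}"
    by (intro finite_measure_mono)
  also have "\<dots> \<le> 1 / exp (s * x)"
    using mgf(1) Y_mean
    by (intro partial_product_maximal_inequality Y_indep inj) (auto simp: Y_eq)
  also have "\<dots> = exp (- (2 * c * x / \<sigma>\<^sup>2))"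
    by (simp add: s_def exp_minus field_simps)
  finally show ?thesis .
qed

text \<open>
  Enumerating an interval from its left end upwards turns uniformity in the number of terms into
  uniformity in the right end of the interval; enumerating it downwards, as in the next lemma, gives
  uniformity in the left end.
\<close>

lemma (in prob_space) sub_Gaussian_forward_boundary:
  fixes X :: "nat \<Rightarrow> 'a \<Rightarrow> real"
  assumes indep: "indep_vars (\<lambda>_. borel) X {s..e}"
    and subg: "\<And>j. j \<in> {s..e} \<Longrightarrow> sub_Gaussian M (X j) \<sigma>"
    and mean: "\<And>j. j \<in> {s..e} \<Longrightarrow> expectation (X j) = 0"
    and "0 < \<sigma>" "0 \<le> c"
  shows "prob {\<omega> \<in> space M. \<exists>b\<in>{s..e}. c * real (b + 1 - s) + x \<le> (\<Sum>j=s..b. X j \<omega>)}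
    \<le> exp (- (2 * c * x / \<sigma>\<^sup>2))"
proof -
  let ?h = "\<lambda>j. s + j - 1"
  have img: "?h ` {1..b + 1 - s} = {s..b}" for b
  proof safe
    fix j assume "j \<in> {s..b}"
    then show "j \<in> ?h ` {1..b + 1 - s}"
      by (intro image_eqI[of _ _ "j + 1 - s"]) auto
  qed auto
  have inj: "inj_on ?h {1..k}" for k
    by (auto simp: inj_on_def)
  have sum_eq: "(\<Sum>j=1..b + 1 - s. X (?h j) \<omega>) = (\<Sum>j=s..b. X j \<omega>)" for b \<omega>
    using sum.reindex[OF inj, of "\<lambda>j. X j \<omega>" "b + 1 - s"] unfolding img by simp
  have "{\<omega> \<in> space M. \<exists>b\<in>{s..e}. c * real (b + 1 - s) + x \<le> (\<Sum>j=s..b. X j \<omega>)}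
      = {\<omega> \<in> space M. \<exists>k\<in>{1..e + 1 - s}. c * real k + x \<le> (\<Sum>j=1..k. X (?h j) \<omega>)}"
  proof -
    have "{1..e + 1 - s} = (\<lambda>b. b + 1 - s) ` {s..e}"
    proof safe
      fix k assume "k \<in> {1..e + 1 - s}"
      then show "k \<in> (\<lambda>b. b + 1 - s) ` {s..e}"
        by (intro image_eqI[of _ _ "k + s - 1"]) auto
    qed auto
    then show ?thesis unfolding sum_eq[symmetric] by force
  qed
  also have "prob \<dots> \<le> exp (- (2 * c * x / \<sigma>\<^sup>2))"
  proof (intro sub_Gaussian_linear_boundary inj)
    show "indep_vars (\<lambda>_. borel) X (?h ` {1..e + 1 - s})"
      unfolding img by (rule indep)
    show "sub_Gaussian M (X (?h j)) \<sigma>" "expectation (X (?h j)) = 0" if "j \<in> {1..e + 1 - s}" for j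
      using subg mean imageI[OF that, of ?h] unfolding img by blast+
  qed fact+
  finally show ?thesis .
qed

lemma (in prob_space) sub_Gaussian_backward_boundary:
  fixes X :: "nat \<Rightarrow> 'a \<Rightarrow> real"
  assumes indep: "indep_vars (\<lambda>_. borel) X {s..e}"
    and subg: "\<And>j. j \<in> {s..e} \<Longrightarrow> sub_Gaussian M (X j) \<sigma>"
    and mean: "\<And>j. j \<in> {s..e} \<Longrightarrow> expectation (X j) = 0"
    and "0 < \<sigma>" "0 \<le> c"
  shows "prob {\<omega> \<in> space M. \<exists>a\<in>{s..e}. c * real (e + 1 - a) + x \<le> (\<Sum>j=a..e. X j \<omega>)}
    \<le> exp (- (2 * c * x / \<sigma>\<^sup>2))"
proof -
  let ?h = "\<lambda>j. e + 1 - j"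
  have img: "?h ` {1..e + 1 - a} = {a..e}" for a
  proof safe
    fix j assume "j \<in> {a..e}"
    then show "j \<in> ?h ` {1..e + 1 - a}"
      by (intro image_eqI[of _ _ "e + 1 - j"]) auto
  qed auto
  have inj: "inj_on ?h {1..e + 1 - a}" for a
    by (auto simp: inj_on_def)
  have sum_eq: "(\<Sum>j=1..e + 1 - a. X (?h j) \<omega>) = (\<Sum>j=a..e. X j \<omega>)" for a \<omega>
    using sum.reindex[OF inj, of "\<lambda>j. X j \<omega>" a] unfolding img by simp
  have "{\<omega> \<in> space M. \<exists>a\<in>{s..e}. c * real (e + 1 - a) + x \<le> (\<Sum>j=a..e. X j \<omega>)}
      = {\<omega> \<in> space M. \<exists>k\<in>{1..e + 1 - s}. c * real k + x \<le> (\<Sum>j=1..k. X (?h j) \<omega>)}"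
  proof -
    have "{1..e + 1 - s} = (\<lambda>a. e + 1 - a) ` {s..e}"
    proof safe
      fix k assume "k \<in> {1..e + 1 - s}"
      then show "k \<in> (\<lambda>a. e + 1 - a) ` {s..e}"
        by (intro image_eqI[of _ _ "e + 1 - k"]) auto
    qed auto
    then show ?thesis unfolding sum_eq[symmetric] by force
  qed
  also have "prob \<dots> \<le> exp (- (2 * c * x / \<sigma>\<^sup>2))"
  proof (intro sub_Gaussian_linear_boundary inj)
    show "indep_vars (\<lambda>_. borel) X (?h ` {1..e + 1 - s})"
      unfolding img by (rule indep)
    show "sub_Gaussian M (X (?h j)) \<sigma>" "expectation (X (?h j)) = 0" if "j \<in> {1..e + 1 - s}" for j
      using subg mean imageI[OF that, of ?h] unfolding img by blast+
  qed fact+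
  finally show ?thesis .
qed

section \<open>Deviations of interval sums around a point\<close>

lemma (in prob_space) sub_Gaussian_centered:
  assumes "sub_Gaussian M X \<sigma>"
  shows "sub_Gaussian M (\<lambda>\<omega>. X \<omega> - expectation X) \<sigma>"
    and "expectation (\<lambda>\<omega>. X \<omega> - expectation X) = 0"
proof -
  show "expectation (\<lambda>\<omega>. X \<omega> - expectation X) = 0"
    using assms by (subst Bochner_Integration.integral_diff) (auto simp: sub_Gaussian_def prob_space)
  then show "sub_Gaussian M (\<lambda>\<omega>. X \<omega> - expectation X) \<sigma>"
    using assms unfolding sub_Gaussian_def by (simp add: prob_space)
qed

lemma sub_Gaussian_uminus:
  assumes "sub_Gaussian M X \<sigma>"
  shows "sub_Gaussian M (\<lambda>\<omega>. - X \<omega>) \<sigma>"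
proof -
  have eq: "s * (- X \<omega> - (\<integral>\<omega>'. - X \<omega>' \<partial>M)) = (- s) * (X \<omega> - (\<integral>\<omega>'. X \<omega>' \<partial>M))" for s \<omega>
    by (simp add: algebra_simps)
  have sq: "s\<^sup>2 = (- s)\<^sup>2" for s :: real
    by simp
  show ?thesis
    unfolding sub_Gaussian_def eq
    using assms unfolding sub_Gaussian_def by (metis sq integrable_minus)
qed

lemma less_ln_2_div_exp_1:
  assumes "\<delta> < ln 2 / exp 1"
  shows "\<delta> < ln 2" "\<delta> < (1::real)"
proof -
  have "ln 2 / exp 1 \<le> (ln 2 :: real)"
    by (simp add: divide_le_eq)
  then show "\<delta> < ln 2" "\<delta> < 1"
    using assms ln_2_less_1 by linarith+
qed

text \<open>
  Each summand of the error bound pays for one position of the interval \<open>{a..b}\<close> of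
  \<open>fused_lasso_run_score\<close> in the piece: the first for intervals that touch exactly one end of the
  piece, the second for intervals that touch neither, the third for the whole piece. The condition
  \<open>\<delta> < ln 2 / exp 1\<close> makes \<open>ln (2 * m) / \<delta>\<close> at least 1, even for \<open>m = 1\<close>, where \<open>ln (ln (2 * m))\<close> is
  negative.
\<close>

lemma error_bound_ge:
  assumes "0 < \<sigma>" "0 < lam" "0 < d" "0 < m" "0 < \<delta>" "\<delta> < ln 2 / exp 1"
  shows "4 * \<sigma> * sqrt (ln (1 / \<delta>) / real d) \<le> error_bound \<sigma> lam d m \<delta>"
    and "4 * \<sigma>\<^sup>2 / lam * ln (ln (2 * real m) / \<delta>) \<le> error_bound \<sigma> lam d m \<delta>"
    and "(2 * sqrt (real m * \<sigma>\<^sup>2 * ln (1 / \<delta>)) + 2 * lam) / real m \<le> error_bound \<sigma> lam d m \<delta>"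
    and "0 \<le> ln (ln (2 * real m) / \<delta>)"
proof -
  note \<delta>_less = less_ln_2_div_exp_1[OF assms(6)]
  then have l: "0 \<le> ln (1 / \<delta>)"
    using assms by simp
  have "ln (2::real) \<le> ln (2 * real m)"
    using assms by simp
  with \<delta>_less(1) have "\<delta> \<le> ln (2 * real m)"
    by linarith
  then have "1 \<le> ln (2 * real m) / \<delta>" and ln_pos: "0 < ln (2 * real m)"
    using assms by (simp_all add: le_divide_eq)
  then show A: "0 \<le> ln (ln (2 * real m) / \<delta>)"
    by (intro ln_ge_zero)
  have A_eq: "ln (ln (2 * real m) / \<delta>) = ln (ln (2 * real m)) + ln (1 / \<delta>)"
    using ln_pos assms by (simp add: ln_div)
  \<comment> \<open>The argument of the outer logarithm is at least 1, since \<open>2 * max 3 d \<ge> 6 > exp 1\<close>.\<close>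
  have "1 \<le> ln (2 * max 3 (real d))"
  proof -
    have "exp 1 \<le> 2 * max 3 (real d)"
      using exp_le by simp
    then show ?thesis
      by (simp add: ln_ge_iff less_max_iff_disj)
  qed
  then have lil: "0 \<le> sqrt (ln (ln (2 * max 3 (real d))) / max 3 (real d))"
    by (intro real_sqrt_ge_zero divide_nonneg_nonneg ln_ge_zero) auto
  let ?B1 = "4 * \<sigma> * (sqrt (ln (ln (2 * max 3 (real d))) / max 3 (real d)) + sqrt (ln (1 / \<delta>) / real d))"
  let ?B2 = "4 * \<sigma>\<^sup>2 * ((ln (ln (2 * real m)) + ln (1 / \<delta>)) / lam)"
  let ?B3 = "(2 * sqrt (real m * \<sigma>\<^sup>2 * ln (1 / \<delta>)) + 2 * lam) / real m"
  have B1: "4 * \<sigma> * sqrt (ln (1 / \<delta>) / real d) \<le> ?B1"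
    using lil \<open>0 < \<sigma>\<close> by (intro mult_left_mono) auto
  have B2_eq: "?B2 = 4 * \<sigma>\<^sup>2 / lam * ln (ln (2 * real m) / \<delta>)"
    by (simp add: A_eq)
  have "0 \<le> 4 * \<sigma> * sqrt (ln (1 / \<delta>) / real d)" "0 \<le> ?B2" "0 \<le> ?B3"
    using l A assms unfolding B2_eq by simp_all
  with B1 show "4 * \<sigma> * sqrt (ln (1 / \<delta>) / real d) \<le> error_bound \<sigma> lam d m \<delta>"
      "4 * \<sigma>\<^sup>2 / lam * ln (ln (2 * real m) / \<delta>) \<le> error_bound \<sigma> lam d m \<delta>"
      "?B3 \<le> error_bound \<sigma> lam d m \<delta>"
    unfolding error_bound_def B2_eq[symmetric] by linarith+
qed

text \<open>
  The total failure probability of the five events of \<open>interval_sum_excess_prob\<close>. As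
  \<open>\<delta> \<le> \<delta> / ln 2 \<le> 1\<close>, each of the four eighth powers is at most \<open>(\<delta> / ln 2)\<^sup>2\<close>.
\<close>

lemma failure_probability_sum_le:
  fixes \<delta> :: real
  assumes "0 < \<delta>" "\<delta> < ln 2 / exp 1" "0 < m"
  shows "\<delta>\<^sup>2 + 2 * \<delta> ^ 8 + 2 * (\<delta> / ln (2 * real m)) ^ 8 \<le> (1 + 24 / (ln 2)\<^sup>2) * \<delta>\<^sup>2"
proof -
  let ?q = "\<delta> / ln 2"
  have "\<delta> < ln 2"
    by (rule less_ln_2_div_exp_1[OF assms(2)])
  then have q: "0 \<le> ?q" "?q \<le> 1"
    using assms(1) by simp_all
  have "ln 2 < (1::real)"
    by (rule ln_2_less_1)
  then have "\<delta> \<le> ?q"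
    using assms(1) by (simp add: le_divide_eq)
  then have "\<delta> ^ 8 \<le> ?q ^ 8"
    using assms(1) by (intro power_mono) auto
  moreover have "(\<delta> / ln (2 * real m)) ^ 8 \<le> ?q ^ 8"
    using assms by (intro power_mono divide_left_mono) auto
  moreover have "?q ^ 8 \<le> ?q ^ 2"
    using q by (intro power_decreasing) auto
  moreover have "(1 + 24 / (ln 2)\<^sup>2) * \<delta>\<^sup>2 = \<delta>\<^sup>2 + 24 * ?q ^ 2"
    by (simp add: power_divide algebra_simps)
  moreover have "0 \<le> ?q ^ 2"
    by simp
  ultimately show ?thesis
    by linarith
qed

text \<open>
  The probabilistic core: with high probability, no interval \<open>{a..b}\<close> around \<open>i\<close> carries an excess of
  the centred score as large as \<open>fused_lasso_run_score\<close> forces on it when the expected score is at most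
  \<open>- B\<close>. All intervals are covered by five line crossings.

  \<^item> The whole piece has a sum of at least \<open>\<beta>1 * m\<close> (event \<open>E1\<close>, probability at most \<open>\<delta>\<^sup>2\<close>).

  \<^item> An interval that touches one end only has at least \<open>d\<close> terms, as it contains \<open>i\<close>, so its sum exceeds
    \<open>\<beta>2\<close> times its length, hence \<open>\<beta>2 / 2\<close> times its length plus \<open>\<beta>2 / 2 * d\<close> (events \<open>E2\<close> and \<open>E3\<close>,
    probability at most \<open>\<delta> ^ 8\<close> each).

  \<^item> An interval that touches neither end gains \<open>2 * lam\<close> from the penalty. It is cut behind \<open>i\<close>, and one of
    its two parts exceeds \<open>c\<close> times its length plus \<open>lam\<close> (events \<open>E4\<close> and \<open>E5\<close>, probability at most
    \<open>(\<delta> / ln (2 * m)) ^ 8\<close> each).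
\<close>

lemma (in prob_space) interval_sum_excess_prob:
  fixes Z :: "nat \<Rightarrow> 'a \<Rightarrow> real"
  assumes indep: "indep_vars (\<lambda>_. borel) Z {s..e}"
    and subg: "\<And>j. j \<in> {s..e} \<Longrightarrow> sub_Gaussian M (Z j) \<sigma>"
    and mean: "\<And>j. j \<in> {s..e} \<Longrightarrow> expectation (Z j) = 0"
    and \<sigma>: "0 < \<sigma>" and lam: "0 < lam" and i: "s \<le> i" "i \<le> e"
    and \<delta>: "0 < \<delta>" "\<delta> < ln 2 / exp 1"
    and m: "m = e + 1 - s" and d: "d = min (i + 1 - s) (e + 1 - i)"
    and B: "B = error_bound \<sigma> lam d m \<delta>"
  obtains E where "E \<in> events" "prob E \<le> (1 + 24 / (ln 2)\<^sup>2) * \<delta>\<^sup>2"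
    "\<And>\<omega> a b. \<omega> \<in> space M \<Longrightarrow> a \<in> {s..i} \<Longrightarrow> b \<in> {i..e} \<Longrightarrow>
       B * real (b + 1 - a) + lam * ((if a = s then -1 else 1) + (if b = e then -1 else 1)) \<le> (\<Sum>j=a..b. Z j \<omega>) \<Longrightarrow> \<omega> \<in> E"
proof -
  have "0 < d" "0 < m"
    using i by (auto simp: m d)
  define l where "l = ln (1 / \<delta>)"
  define A where "A = ln (ln (2 * real m) / \<delta>)"
  define \<beta>1 where "\<beta>1 = 2 * sqrt (real m * \<sigma>\<^sup>2 * l) / real m"
  define \<beta>2 where "\<beta>2 = 4 * \<sigma> * sqrt (l / real d)"
  define c where "c = 4 * \<sigma>\<^sup>2 / lam * A"
  note bounds = error_bound_ge[OF \<sigma> lam \<open>0 < d\<close> \<open>0 < m\<close> \<delta>, folded B l_def A_def]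
  have \<beta>1: "\<beta>1 * real m + 2 * lam \<le> B * real m"
    using bounds(3) \<open>0 < m\<close> by (simp add: \<beta>1_def divide_le_eq)
  have \<beta>2: "\<beta>2 \<le> B" and c: "c \<le> B"
    using bounds(1,2) by (simp_all add: \<beta>2_def c_def)
  have "\<delta> < 1"
    by (rule less_ln_2_div_exp_1[OF \<delta>(2)])
  then have l: "0 \<le> l"
    using \<delta> by (simp add: l_def)
  have exp_l: "exp (- (real k * l)) = \<delta> ^ k" for k
    using \<delta> by (simp add: l_def ln_div exp_of_nat_mult)
  have exp_A: "exp (- (8 * A)) = (\<delta> / ln (2 * real m)) ^ 8"
  proof -
    have "exp (- (8 * A)) = exp (- A) ^ 8"
      by (simp add: exp_of_nat_mult[symmetric])
    also have "exp (- A) = \<delta> / ln (2 * real m)"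
      using \<delta> \<open>0 < m\<close> by (simp add: A_def exp_minus inverse_eq_divide)
    finally show ?thesis .
  qed
  have nonneg: "0 \<le> \<beta>1" "0 \<le> \<beta>2" "0 \<le> c"
    using l bounds(4) \<sigma> lam by (simp_all add: \<beta>1_def \<beta>2_def c_def)
  let ?F = "\<lambda>s e c x. {\<omega> \<in> space M. \<exists>b\<in>{s..e}. c * real (b + 1 - s) + x \<le> (\<Sum>j=s..b. Z j \<omega>)}"
  let ?R = "\<lambda>s e c x. {\<omega> \<in> space M. \<exists>a\<in>{s..e}. c * real (e + 1 - a) + x \<le> (\<Sum>j=a..e. Z j \<omega>)}"
  have Z_meas: "random_variable borel (Z j)" if "j \<in> {s..e}" for j
    using indep that unfolding indep_vars_def2 by auto
  have F_sets: "?F s' e' c x \<in> events" and R_sets: "?R s' e' c x \<in> events"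
    if "{s'..e'} \<subseteq> {s..e}" for s' e' c x
    using that
    by (intro sets.sets_Collect_finite_Ex borel_measurable_le borel_measurable_sum
          borel_measurable_const Z_meas; force)+
  have F_prob: "prob (?F s' e' c x) \<le> exp (- (2 * c * x / \<sigma>\<^sup>2))"
    and R_prob: "prob (?R s' e' c x) \<le> exp (- (2 * c * x / \<sigma>\<^sup>2))"
    if "{s'..e'} \<subseteq> {s..e}" "0 \<le> c" for s' e' c x
    using subg mean \<sigma> that(1)
    by (intro sub_Gaussian_forward_boundary sub_Gaussian_backward_boundary
          indep_vars_subset[OF indep that(1)] that(2); blast)+
  define E1 where "E1 = ?F s e (\<beta>1 / 2) (real m * \<beta>1 / 2)"
  define E2 where "E2 = ?F s e (\<beta>2 / 2) (real d * \<beta>2 / 2)"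
  define E3 where "E3 = ?R s e (\<beta>2 / 2) (real d * \<beta>2 / 2)"
  define E4 where "E4 = ?R s i c lam"
  define E5 where "E5 = ?F (i + 1) e c lam"
  note E_defs = E1_def E2_def E3_def E4_def E5_def
  have "{s..i} \<subseteq> {s..e}" "{i + 1..e} \<subseteq> {s..e}"
    using i by auto
  then have E_sets: "E1 \<in> events" "E2 \<in> events" "E3 \<in> events" "E4 \<in> events" "E5 \<in> events"
    unfolding E_defs by (intro F_sets R_sets; simp)+
  have \<beta>1_sq: "2 * (\<beta>1 / 2) * (real m * \<beta>1 / 2) / \<sigma>\<^sup>2 = real 2 * l"
  proof -
    have "\<beta>1 * \<beta>1 = 4 * (real m * \<sigma>\<^sup>2 * l) / (real m * real m)"
      using l by (simp add: \<beta>1_def)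
    then have "real m * (\<beta>1 * \<beta>1) = 4 * \<sigma>\<^sup>2 * l"
      using \<open>0 < m\<close> by simp
    then show ?thesis
      using \<sigma> by (simp add: divide_simps mult_ac)
  qed
  have \<beta>2_sq: "2 * (\<beta>2 / 2) * (real d * \<beta>2 / 2) / \<sigma>\<^sup>2 = real 8 * l"
  proof -
    have "\<beta>2 * \<beta>2 = 16 * \<sigma>\<^sup>2 * (sqrt (l / real d) * sqrt (l / real d))"
      by (simp add: \<beta>2_def power2_eq_square del: real_sqrt_mult_self)
    also have "sqrt (l / real d) * sqrt (l / real d) = l / real d"
      using l by (simp del: real_sqrt_divide)
    finally have "real d * (\<beta>2 * \<beta>2) = 16 * \<sigma>\<^sup>2 * l"
      using \<open>0 < d\<close> by simp
    then show ?thesis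
      using \<sigma> by (simp add: divide_simps mult_ac)
  qed
  have c_lam: "2 * c * lam / \<sigma>\<^sup>2 = 8 * A"
    using \<sigma> lam by (simp add: c_def)
  have half: "0 \<le> \<beta>1 / 2" "0 \<le> \<beta>2 / 2"
    using nonneg by simp_all
  have "prob E1 \<le> \<delta> ^ 2"
    using F_prob[OF order_refl half(1), of "real m * \<beta>1 / 2"] unfolding E1_def \<beta>1_sq exp_l .
  moreover have "prob E2 \<le> \<delta> ^ 8"
    using F_prob[OF order_refl half(2), of "real d * \<beta>2 / 2"] unfolding E2_def \<beta>2_sq exp_l .
  moreover have "prob E3 \<le> \<delta> ^ 8"
    using R_prob[OF order_refl half(2), of "real d * \<beta>2 / 2"] unfolding E3_def \<beta>2_sq exp_l .
  moreover have "prob E4 \<le> (\<delta> / ln (2 * real m)) ^ 8"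
    using R_prob[OF \<open>{s..i} \<subseteq> {s..e}\<close> nonneg(3), of lam] unfolding E4_def c_lam exp_A .
  moreover have "prob E5 \<le> (\<delta> / ln (2 * real m)) ^ 8"
    using F_prob[OF \<open>{i + 1..e} \<subseteq> {s..e}\<close> nonneg(3), of lam] unfolding E5_def c_lam exp_A .
  moreover have "prob (E1 \<union> E2 \<union> E3 \<union> E4 \<union> E5) \<le> prob E1 + prob E2 + prob E3 + prob E4 + prob E5"
    using E_sets by (intro order_trans[OF measure_Un_le] add_mono order_refl sets.Un)
  ultimately have "prob (E1 \<union> E2 \<union> E3 \<union> E4 \<union> E5) \<le> (1 + 24 / (ln 2)\<^sup>2) * \<delta>\<^sup>2"
    using failure_probability_sum_le[OF \<delta> \<open>0 < m\<close>] by linarith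
  moreover have "\<omega> \<in> E1 \<union> E2 \<union> E3 \<union> E4 \<union> E5"
    if \<omega>: "\<omega> \<in> space M" and ab: "a \<in> {s..i}" "b \<in> {i..e}"
      and ex: "B * real (b + 1 - a) + lam * ((if a = s then -1 else 1) + (if b = e then -1 else 1)) \<le> (\<Sum>j=a..b. Z j \<omega>)" for \<omega> a b
  proof -
    consider "a = s" "b = e" | "a = s" "b \<noteq> e" | "a \<noteq> s" "b = e" | "a \<noteq> s" "b \<noteq> e"
      by blast
    then show ?thesis
    proof cases
      case 1
      have "B * real m - 2 * lam \<le> (\<Sum>j=s..e. Z j \<omega>)"
        using ex unfolding 1 m by simp
      with \<beta>1 have "\<beta>1 / 2 * real m + real m * \<beta>1 / 2 \<le> (\<Sum>j=s..e. Z j \<omega>)"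
        by (simp add: mult.commute)
      then have "\<omega> \<in> E1"
        using \<omega> i unfolding E1_def m by fastforce
      then show ?thesis by simp
    next
      case 2
      have "\<beta>2 / 2 * real (b + 1 - s) + \<beta>2 / 2 * real d \<le> \<beta>2 / 2 * real (b + 1 - s) + \<beta>2 / 2 * real (b + 1 - s)"
        using nonneg ab by (intro add_left_mono mult_left_mono) (auto simp: d)
      also have "\<dots> = \<beta>2 * real (b + 1 - s)"
        by simp
      also have "\<dots> \<le> B * real (b + 1 - s)"
        by (intro mult_right_mono \<beta>2) simp
      finally have "\<omega> \<in> E2"
        using ex \<omega> ab i 2 unfolding E2_def by (auto simp: mult_ac intro!: bexI[of _ b])
      then show ?thesis by simp
    next
      case 3
      have "\<beta>2 / 2 * real (e + 1 - a) + \<beta>2 / 2 * real d \<le> \<beta>2 / 2 * real (e + 1 - a) + \<beta>2 / 2 * real (e + 1 - a)"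
        using nonneg ab by (intro add_left_mono mult_left_mono) (auto simp: d)
      also have "\<dots> = \<beta>2 * real (e + 1 - a)"
        by simp
      also have "\<dots> \<le> B * real (e + 1 - a)"
        by (intro mult_right_mono \<beta>2) simp
      finally have "\<omega> \<in> E3"
        using ex \<omega> ab i 3 unfolding E3_def by (auto simp: mult_ac intro!: bexI[of _ a])
      then show ?thesis by simp
    next
      case 4
      let ?l = "real (i + 1 - a)" and ?r = "real (b + 1 - (i + 1))"
      have "real (b + 1 - a) = ?l + ?r"
        using ab by (simp add: of_nat_diff)
      moreover have "c * real (b + 1 - a) \<le> B * real (b + 1 - a)"
        by (intro mult_right_mono c) simp
      moreover have "(\<Sum>j=a..b. Z j \<omega>) = (\<Sum>j=a..i. Z j \<omega>) + (\<Sum>j=i+1..b. Z j \<omega>)"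
        using ab sum.ub_add_nat[of a i "\<lambda>j. Z j \<omega>" "b - i"] by simp
      ultimately have sums: "(c * ?l + lam) + (c * ?r + lam) \<le> (\<Sum>j=a..i. Z j \<omega>) + (\<Sum>j=i+1..b. Z j \<omega>)"
        using ex 4 by (simp add: algebra_simps)
      show ?thesis
      proof (cases "c * ?l + lam \<le> (\<Sum>j=a..i. Z j \<omega>)")
        case True
        then have "\<omega> \<in> E4"
          using \<omega> ab unfolding E4_def by blast
        then show ?thesis by simp
      next
        case False
        with sums have right: "c * ?r + lam \<le> (\<Sum>j=i+1..b. Z j \<omega>)"
          by linarith
        \<comment> \<open>If \<open>b = i\<close>, the right part is empty and its sum 0 is below \<open>lam\<close>.\<close>
        have "b \<noteq> i"
          using right lam by auto
        then have "\<omega> \<in> E5"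
          using right \<omega> ab unfolding E5_def by force
        then show ?thesis by simp
      qed
    qed
  qed
  ultimately show ?thesis
    using E_sets by (intro that[of "E1 \<union> E2 \<union> E3 \<union> E4 \<union> E5"] sets.Un)
qed

section \<open>Random thresholds\<close>

text \<open>
  An up-closed set of reals is a closed or an open half-line, or everything; in each case closed
  half-lines exhaust it from inside.
\<close>

lemma up_closed_real_set_as_union:
  fixes U :: "real set"
  assumes up: "\<And>u v. u \<in> U \<Longrightarrow> u \<le> v \<Longrightarrow> v \<in> U" and "U \<noteq> {}"
  obtains u :: "nat \<Rightarrow> real" where "decseq u" "range u \<subseteq> U" "U = (\<Union>k. {u k..})"
proof -
  have *: "U = (\<Union>k. {u k..})"
    if "range u \<subseteq> U" "\<And>v. v \<in> U \<Longrightarrow> \<exists>k. u k \<le> v" for u :: "nat \<Rightarrow> real"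
    using that up by auto
  show ?thesis
  proof (cases "bdd_below U")
    case False
    have "\<exists>v\<in>U. v \<le> x" for x
      using False unfolding bdd_below_def by (meson linear)
    then have mem: "x \<in> U" for x
      using up by blast
    have "\<exists>k. - real k \<le> v" for v
      using real_arch_simple[of "- v"] by (auto simp: minus_le_iff)
    then show ?thesis
      using mem by (intro that[of "\<lambda>k. - real k"] *) (auto simp: decseq_def)
  next
    case True
    show ?thesis
    proof (cases "Inf U \<in> U")
      case True
      then show ?thesis
        using \<open>bdd_below U\<close>
        by (intro that[of "\<lambda>_. Inf U"] *) (auto simp: decseq_def intro: cInf_lower)
    next
      case False
      let ?u = "\<lambda>k. Inf U + 1 / real (Suc k)"
      have "?u k \<in> U" for k
      proof -
        have "Inf U < ?u k" by simp
        then obtain v where "v \<in> U" "v < ?u k"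
          using cInf_less_iff[OF \<open>U \<noteq> {}\<close> True] by blast
        then show ?thesis using up by auto
      qed
      moreover have "\<exists>k. ?u k \<le> v" if "v \<in> U" for v
      proof -
        have "Inf U < v"
          using cInf_lower[OF that True] that False by (cases "Inf U = v") auto
        then obtain k where "inverse (real (Suc k)) < v - Inf U"
          using reals_Archimedean[of "v - Inf U"] by auto
        then show ?thesis
          by (intro exI[of _ k]) (simp add: inverse_eq_divide)
      qed
      moreover have "decseq ?u"
        by (auto simp: decseq_def frac_le)
      ultimately show ?thesis
        by (intro that[of ?u] *) auto
    qed
  qed
qed

text \<open>
  The thresholds \<open>t\<close> with \<open>L_plus \<rho> D t \<le> - B\<close> form an up-closed set, whose infimum need not belong to
  it. A bound that holds for each fixed threshold passes to the whole set by continuity from below.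
\<close>

lemma (in prob_space) random_threshold_prob_le:
  fixes T :: "'a \<Rightarrow> real"
  assumes [measurable]: "random_variable borel T"
    and up: "\<And>u v. u \<in> U \<Longrightarrow> u \<le> v \<Longrightarrow> v \<in> U"
    and le: "\<And>u. u \<in> U \<Longrightarrow> prob {\<omega> \<in> space M. u \<le> T \<omega>} \<le> q" and "0 \<le> q"
  shows "prob {\<omega> \<in> space M. T \<omega> \<in> U} \<le> q"
proof (cases "U = {}")
  case True
  then show ?thesis using \<open>0 \<le> q\<close> by simp
next
  case False
  obtain u where u: "decseq u" "range u \<subseteq> U" "U = (\<Union>k. {u k..})"
    by (rule up_closed_real_set_as_union[of U, OF up False])
  let ?A = "\<lambda>k. {\<omega> \<in> space M. u k \<le> T \<omega>}"
  have "(\<lambda>k. prob (?A k)) \<longlonglongrightarrow> prob (\<Union>k. ?A k)"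
    using decseqD[OF u(1)]
    by (intro finite_Lim_measure_incseq) (auto simp: incseq_def intro: order_trans)
  moreover have "(\<Union>k. ?A k) = {\<omega> \<in> space M. T \<omega> \<in> U}"
    unfolding u(3) by auto
  moreover have "prob (?A k) \<le> q" for k
    using u(2) by (intro le) auto
  ultimately show ?thesis
    by (intro LIMSEQ_le_const2) auto
qed

text \<open>
  The step from a random to a fixed threshold. Since \<open>\<psi>\<close> is monotone, replacing \<open>T \<omega>\<close> by a smaller
  fixed \<open>t\<close> only increases the score sums, which become sums of independent variables with mean
  \<open>L t \<le> - B\<close>; centring them contributes \<open>B\<close> per term.
\<close>

lemma (in prob_space) score_deviation_prob:
  fixes \<psi> :: "real \<Rightarrow> real" and \<epsilon> :: "nat \<Rightarrow> 'a \<Rightarrow> real" and T :: "'a \<Rightarrow> real"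
  assumes \<psi>: "mono \<psi>"
    and indep: "indep_vars (\<lambda>_. borel) \<epsilon> {s..e}"
    and distr: "\<And>j. j \<in> {s..e} \<Longrightarrow> distr M borel (\<epsilon> j) = D"
    and subg: "\<And>j t. j \<in> {s..e} \<Longrightarrow> sub_Gaussian M (\<lambda>\<omega>. \<psi> (\<epsilon> j \<omega> - t)) \<sigma>"
    and T: "random_variable borel T"
    and run: "\<And>\<omega>. \<omega> \<in> space M \<Longrightarrow> \<exists>a\<in>{s..i}. \<exists>b\<in>{i..e}.
        lam * ((if a = s then -1 else 1) + (if b = e then -1 else 1))
          \<le> (\<Sum>j=a..b. \<psi> (\<epsilon> j \<omega> - T \<omega>))"
    and \<sigma>: "0 < \<sigma>" and lam: "0 < lam" and i: "s \<le> i" "i \<le> e"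
    and \<delta>: "0 < \<delta>" "\<delta> < ln 2 / exp 1"
  shows "prob {\<omega> \<in> space M. (\<integral>x. \<psi> (x - T \<omega>) \<partial>D)
        \<le> - error_bound \<sigma> lam (min (i + 1 - s) (e + 1 - i)) (e + 1 - s) \<delta>}
      \<le> (1 + 24 / (ln 2)\<^sup>2) * \<delta>\<^sup>2"
proof -
  define B where "B = error_bound \<sigma> lam (min (i + 1 - s) (e + 1 - i)) (e + 1 - s) \<delta>"
  define L where "L t = (\<integral>x. \<psi> (x - t) \<partial>D)" for t
  have [measurable]: "\<psi> \<in> borel_measurable borel"
    by (rule borel_measurable_mono[OF \<psi>])
  have \<epsilon>_meas: "random_variable borel (\<epsilon> j)" if "j \<in> {s..e}" for j
    using indep that unfolding indep_vars_def2 by auto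
  have L_eq: "L t = expectation (\<lambda>\<omega>. \<psi> (\<epsilon> j \<omega> - t))" if "j \<in> {s..e}" for j t
    unfolding L_def distr[OF that, symmetric]
    by (subst integral_distr[OF \<epsilon>_meas[OF that]]) auto
  have L_antimono: "L v \<le> L u" if "u \<le> v" for u v
  proof -
    have "s \<in> {s..e}" using i by simp
    from subg[OF this] show ?thesis
      unfolding L_eq[OF \<open>s \<in> {s..e}\<close>] using that
      by (intro integral_mono monoD[OF \<psi>]) (auto simp: sub_Gaussian_def)
  qed
  have "prob {\<omega> \<in> space M. T \<omega> \<in> {t. L t \<le> - B}} \<le> (1 + 24 / (ln 2)\<^sup>2) * \<delta>\<^sup>2"
  proof (rule random_threshold_prob_le[OF T])
    show "v \<in> {t. L t \<le> - B}" if "u \<in> {t. L t \<le> - B}" "u \<le> v" for u v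
      using that L_antimono[of u v] by auto
    show "prob {\<omega> \<in> space M. t \<le> T \<omega>} \<le> (1 + 24 / (ln 2)\<^sup>2) * \<delta>\<^sup>2" if t: "t \<in> {t. L t \<le> - B}" for t
    proof -
      define Z where "Z j \<omega> = \<psi> (\<epsilon> j \<omega> - t) - L t" for j \<omega>
      have Z_indep: "indep_vars (\<lambda>_. borel) Z {s..e}"
        unfolding Z_def[abs_def] by (rule indep_vars_compose2[OF indep]) measurable
      have Z_subg: "sub_Gaussian M (Z j) \<sigma>" and Z_mean: "expectation (Z j) = 0"
        if "j \<in> {s..e}" for j
        using sub_Gaussian_centered[OF subg[OF that, of t]]
        unfolding Z_def[abs_def] L_eq[OF that] by simp_all
      obtain E where E: "E \<in> events" "prob E \<le> (1 + 24 / (ln 2)\<^sup>2) * \<delta>\<^sup>2"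
        and mem: "\<And>\<omega> a b. \<omega> \<in> space M \<Longrightarrow> a \<in> {s..i} \<Longrightarrow> b \<in> {i..e} \<Longrightarrow>
          B * real (b + 1 - a) + lam * ((if a = s then -1 else 1) + (if b = e then -1 else 1))
            \<le> (\<Sum>j=a..b. Z j \<omega>) \<Longrightarrow> \<omega> \<in> E"
        by (rule interval_sum_excess_prob[OF Z_indep Z_subg Z_mean \<sigma> lam i \<delta> refl refl B_def]) blast+
      have "{\<omega> \<in> space M. t \<le> T \<omega>} \<subseteq> E"
      proof safe
        fix \<omega> assume \<omega>: "\<omega> \<in> space M" "t \<le> T \<omega>"
        obtain a b where ab: "a \<in> {s..i}" "b \<in> {i..e}"
          and ge: "lam * ((if a = s then -1 else 1) + (if b = e then -1 else 1))
            \<le> (\<Sum>j=a..b. \<psi> (\<epsilon> j \<omega> - T \<omega>))"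
          using run[OF \<omega>(1)] by blast
        have "B * real (b + 1 - a) \<le> - L t * real (b + 1 - a)"
          using t by (intro mult_right_mono) auto
        moreover have "(\<Sum>j=a..b. \<psi> (\<epsilon> j \<omega> - T \<omega>)) \<le> (\<Sum>j=a..b. \<psi> (\<epsilon> j \<omega> - t))"
          using \<omega>(2) by (intro sum_mono monoD[OF \<psi>]) simp
        moreover have "(\<Sum>j=a..b. Z j \<omega>) = (\<Sum>j=a..b. \<psi> (\<epsilon> j \<omega> - t)) - L t * real (b + 1 - a)"
          by (simp add: Z_def sum_subtractf)
        ultimately show "\<omega> \<in> E"
          using ge by (intro mem[OF \<omega>(1) ab]) linarith
      qed
      then show ?thesis
        using E by (intro order_trans[OF finite_measure_mono E(2)])
    qed
  qed simp
  then show ?thesis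
    by (simp add: L_def B_def)
qed

section \<open>Deviation of the fused lasso estimator\<close>

text \<open>
  Since \<open>p\<close> is strictly increasing with \<open>p 1 = 1\<close> and \<open>p (K + 1) = n + 1\<close>, the pieces partition \<open>{1..n}\<close>,
  so the definite description in \<open>piece_index\<close> denotes.
\<close>

lemma piecewise_constant_piece:
  assumes pc: "piecewise_constant n K p \<theta>" and i: "i \<in> {1..n}"
  shows "piece_index K p i \<in> {1..K}"
    and "p (piece_index K p i) \<le> i" "i < p (piece_index K p i + 1)"
    and "1 \<le> p (piece_index K p i)" "p (piece_index K p i + 1) \<le> n + 1"
proof -
  have K: "1 \<le> K" "p 1 = 1" "p K < n" "p (K + 1) = n + 1" and smono: "strict_mono_on {1..K} p"
    using pc unfolding piecewise_constant_def by auto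
  have mono: "p k \<le> p l" if "1 \<le> k" "k \<le> l" "l \<le> K + 1" for k l
  proof -
    have le: "p k' \<le> p l'" if "1 \<le> k'" "k' \<le> l'" "l' \<le> K" for k' l'
      using strict_mono_on_leD[OF smono] that by auto
    show ?thesis
    proof (cases "l = K + 1")
      case True
      then show ?thesis
        using le[of k K] K that by (cases "k = K + 1") auto
    qed (use le[of k l] that in auto)
  qed
  let ?Q = "\<lambda>k. 1 \<le> k \<and> k \<le> K \<and> p k \<le> i"
  define k where "k = (GREATEST k. ?Q k)"
  have "?Q 1"
    using K i by simp
  then have k: "?Q k"
    unfolding k_def by (rule GreatestI_nat[where b = K]) simp
  have "i < p (k + 1)"
  proof (rule ccontr)
    assume "\<not> i < p (k + 1)"
    then have "?Q (k + 1)"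
      using k K i by (cases "k = K") auto
    then have "k + 1 \<le> k"
      unfolding k_def by (rule Greatest_le_nat[where b = K]) simp
    then show False by simp
  qed
  have "piece_index K p i = k"
    unfolding piece_index_def
  proof (rule the_equality)
    show "k \<in> {1..K} \<and> i \<in> {p k..<p (k + 1)}"
      using k \<open>i < p (k + 1)\<close> by simp
    show "l = k" if "l \<in> {1..K} \<and> i \<in> {p l..<p (l + 1)}" for l
    proof (rule ccontr)
      assume "l \<noteq> k"
      then have "l + 1 \<le> k \<or> k + 1 \<le> l" by auto
      then show False
        using mono[of "l + 1" k] mono[of "k + 1" l] that k \<open>i < p (k + 1)\<close> by auto
    qed
  qed
  then show "piece_index K p i \<in> {1..K}"
      "p (piece_index K p i) \<le> i" "i < p (piece_index K p i + 1)"
      "1 \<le> p (piece_index K p i)" "p (piece_index K p i + 1) \<le> n + 1"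
    using k \<open>i < p (k + 1)\<close> mono[of 1 k] mono[of "k + 1" "K + 1"] K by auto
qed

lemma fused_lasso_objective_cong:
  assumes "\<And>j. j \<in> {1..n} \<Longrightarrow> \<theta> j = \<theta>' j"
  shows "fused_lasso_objective \<rho> lam n y \<theta> = fused_lasso_objective \<rho> lam n y \<theta>'"
proof -
  have "j + 1 \<in> {1..n} \<and> j \<in> {1..n}" if "j \<in> {1..n - 1}" for j
    using that by auto
  then show ?thesis
    using assms unfolding fused_lasso_objective_def by simp
qed

lemma fused_lasso_objective_reflect:
  "fused_lasso_objective (\<lambda>u. \<rho> (- u)) lam n (\<lambda>j. - y j) (\<lambda>j. - \<theta> j)
    = fused_lasso_objective \<rho> lam n y \<theta>"
  unfolding fused_lasso_objective_def by (simp add: abs_minus_commute)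

text \<open>
  The upper deviation of the estimator on an interval \<open>{s..e}\<close> on which the signal has the constant
  value \<open>c\<close>. On the run found by \<open>fused_lasso_run_score\<close> the estimator is at least \<open>\<theta>h \<omega> i\<close>, so by
  monotonicity its residuals may be replaced by \<open>\<epsilon> j \<omega> - (\<theta>h \<omega> i - c)\<close>.
\<close>

lemma (in prob_space) right_score_deviation_prob:
  fixes \<rho> :: "real \<Rightarrow> real" and \<epsilon> :: "nat \<Rightarrow> 'a \<Rightarrow> real" and \<theta>h :: "'a \<Rightarrow> nat \<Rightarrow> real"
  assumes conv: "convex_on UNIV \<rho>"
    and indep: "indep_vars (\<lambda>_. borel) \<epsilon> {s..e}"
    and distr: "\<And>j. j \<in> {s..e} \<Longrightarrow> distr M borel (\<epsilon> j) = D"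
    and subg: "\<And>j t. j \<in> {s..e} \<Longrightarrow> sub_Gaussian M (\<lambda>\<omega>. right_deriv \<rho> (\<epsilon> j \<omega> - t)) \<sigma>"
    and y: "\<And>j \<omega>. j \<in> {s..e} \<Longrightarrow> \<omega> \<in> space M \<Longrightarrow> y j \<omega> = c + \<epsilon> j \<omega>"
    and meas: "random_variable borel (\<lambda>\<omega>. \<theta>h \<omega> i)"
    and min: "\<And>\<omega> \<theta>. \<omega> \<in> space M \<Longrightarrow>
      fused_lasso_objective \<rho> lam n (\<lambda>j. y j \<omega>) (\<theta>h \<omega>) \<le> fused_lasso_objective \<rho> lam n (\<lambda>j. y j \<omega>) \<theta>"
    and \<sigma>: "0 < \<sigma>" and lam: "0 < lam" and i: "1 \<le> s" "s \<le> i" "i \<le> e" "e \<le> n"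
    and \<delta>: "0 < \<delta>" "\<delta> < ln 2 / exp 1"
  shows "prob {\<omega> \<in> space M. L_plus \<rho> D (\<theta>h \<omega> i - c)
        \<le> - error_bound \<sigma> lam (min (i + 1 - s) (e + 1 - i)) (e + 1 - s) \<delta>}
      \<le> (1 + 24 / (ln 2)\<^sup>2) * \<delta>\<^sup>2"
  unfolding L_plus_def
proof (rule score_deviation_prob[OF right_deriv_mono[OF conv] indep distr subg _ _ \<sigma> lam i(2,3) \<delta>])
  show "random_variable borel (\<lambda>\<omega>. \<theta>h \<omega> i - c)"
    using meas by simp
  show "\<exists>a\<in>{s..i}. \<exists>b\<in>{i..e}. lam * ((if a = s then -1 else 1) + (if b = e then -1 else 1))
      \<le> (\<Sum>j=a..b. right_deriv \<rho> (\<epsilon> j \<omega> - (\<theta>h \<omega> i - c)))" if \<omega>: "\<omega> \<in> space M" for \<omega>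
  proof -
    obtain a b where ab: "a \<in> {s..i}" "b \<in> {i..e}"
      and run: "\<And>j. j \<in> {a..b} \<Longrightarrow> \<theta>h \<omega> i \<le> \<theta>h \<omega> j"
      and ge: "lam * ((if a = s then -1 else 1) + (if b = e then -1 else 1))
        \<le> (\<Sum>j=a..b. right_deriv \<rho> (y j \<omega> - \<theta>h \<omega> j))"
      by (rule fused_lasso_run_score[where \<theta> = "\<theta>h \<omega>" and y = "\<lambda>j. y j \<omega>",
            OF conv less_imp_le[OF lam] min[OF \<omega>] i]) blast
    note ge
    also have "(\<Sum>j=a..b. right_deriv \<rho> (y j \<omega> - \<theta>h \<omega> j))
        \<le> (\<Sum>j=a..b. right_deriv \<rho> (\<epsilon> j \<omega> - (\<theta>h \<omega> i - c)))"
    proof (intro sum_mono monoD[OF right_deriv_mono[OF conv]])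
      fix j assume j: "j \<in> {a..b}"
      then have "j \<in> {s..e}" using ab by auto
      from y[OF this \<omega>] run[OF j] show "y j \<omega> - \<theta>h \<omega> j \<le> \<epsilon> j \<omega> - (\<theta>h \<omega> i - c)"
        by simp
    qed
    finally show ?thesis
      using ab by blast
  qed
qed

theorem theorem1:
  fixes M :: "'a measure" and D :: "real measure"
    and \<rho> :: "real \<Rightarrow> real" and lam \<sigma> \<delta> :: real
    and n K i :: nat and p :: "nat \<Rightarrow> nat"
    and \<theta>s :: "nat \<Rightarrow> real" and \<epsilon> y :: "nat \<Rightarrow> 'a \<Rightarrow> real"
    and \<theta>h :: "'a \<Rightarrow> nat \<Rightarrow> real"
  assumes "prob_space M"
    and "convex_on UNIV \<rho>"
    and "lam > 0"
    and "piecewise_constant n K p \<theta>s"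
    and "prob_space.indep_vars M (\<lambda>_. borel) \<epsilon> {1..n}"
    and "\<And>j. j \<in> {1..n} \<Longrightarrow> distr M borel (\<epsilon> j) = D"
    and "\<And>j \<omega>. j \<in> {1..n} \<Longrightarrow> \<omega> \<in> space M \<Longrightarrow> y j \<omega> = \<theta>s j + \<epsilon> j \<omega>"
    and "\<sigma> > 0"
    and "\<And>j t. j \<in> {1..n} \<Longrightarrow> sub_Gaussian M (\<lambda>\<omega>. right_deriv \<rho> (\<epsilon> j \<omega> - t)) \<sigma>"
    and "\<And>j t. j \<in> {1..n} \<Longrightarrow> sub_Gaussian M (\<lambda>\<omega>. left_deriv \<rho> (\<epsilon> j \<omega> - t)) \<sigma>"
    and "\<theta>h \<in> M \<rightarrow>\<^sub>M (\<Pi>\<^sub>M j\<in>{1..n}. borel)"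
    and "\<And>\<omega>. \<omega> \<in> space M \<Longrightarrow>
           is_arg_min (fused_lasso_objective \<rho> lam n (\<lambda>j. y j \<omega>))
             (\<lambda>\<theta>. \<theta> \<in> {1..n} \<rightarrow>\<^sub>E UNIV) (\<theta>h \<omega>)"
    and "i \<in> {1..n}"
    and "0 < \<delta>" and "\<delta> < ln 2 / exp 1"
  shows "\<P>(\<omega> in M. L_plus \<rho> D (\<theta>h \<omega> i - \<theta>s i)
             \<le> - error_bound \<sigma> lam (boundary_dist K p i) (piece_length p (piece_index K p i)) \<delta>)
           \<le> (1 + 24 / (ln 2)\<^sup>2) * \<delta>\<^sup>2
       \<and> \<P>(\<omega> in M. L_minus \<rho> D (\<theta>h \<omega> i - \<theta>s i)
             \<ge> error_bound \<sigma> lam (boundary_dist K p i) (piece_length p (piece_index K p i)) \<delta>)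
           \<le> (1 + 24 / (ln 2)\<^sup>2) * \<delta>\<^sup>2"
proof -
  interpret prob_space M by fact
  define k where "k = piece_index K p i"
  define s e where "s = p k" and "e = p (k + 1) - 1"
  note piece = piecewise_constant_piece[OF assms(4,13), folded k_def]
  have i: "1 \<le> s" "s \<le> i" "i \<le> e" "e \<le> n" and "{s..e} \<subseteq> {1..n}"
    using piece by (auto simp: s_def e_def)
  have dist: "boundary_dist K p i = min (i + 1 - s) (e + 1 - i)"
    and len: "piece_length p (piece_index K p i) = e + 1 - s"
    using piece by (simp_all add: boundary_dist_def piece_length_def k_def[symmetric] s_def e_def)
  have const: "\<theta>s j = \<theta>s i" if "j \<in> {s..e}" for j
  proof -
    have "\<forall>j\<in>{p k..<p (k + 1)}. \<theta>s j = \<theta>s (p k)"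
      using assms(4) piece(1) unfolding piecewise_constant_def by blast
    moreover have "j \<in> {p k..<p (k + 1)}" "i \<in> {p k..<p (k + 1)}"
      using that piece by (auto simp: s_def e_def)
    ultimately show ?thesis by metis
  qed
  have y: "y j \<omega> = \<theta>s i + \<epsilon> j \<omega>" if "j \<in> {s..e}" "\<omega> \<in> space M" for j \<omega>
    using assms(7)[of j \<omega>] const[of j] that \<open>{s..e} \<subseteq> {1..n}\<close> by auto
  have indep: "indep_vars (\<lambda>_. borel) \<epsilon> {s..e}"
    by (rule indep_vars_subset[OF assms(5) \<open>{s..e} \<subseteq> {1..n}\<close>])
  have \<epsilon>_meas: "random_variable borel (\<epsilon> j)" if "j \<in> {1..n}" for j
    using assms(5) that unfolding indep_vars_def2 by auto
  have meas: "random_variable borel (\<lambda>\<omega>. \<theta>h \<omega> i)"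
    by (rule measurable_compose[OF assms(11) measurable_component_singleton[OF assms(13)]])
  have min: "fused_lasso_objective \<rho> lam n (\<lambda>j. y j \<omega>) (\<theta>h \<omega>)
      \<le> fused_lasso_objective \<rho> lam n (\<lambda>j. y j \<omega>) \<theta>" if "\<omega> \<in> space M" for \<omega> \<theta>
  proof -
    have "restrict \<theta> {1..n} \<in> {1..n} \<rightarrow>\<^sub>E UNIV" by simp
    with assms(12)[OF that] have "fused_lasso_objective \<rho> lam n (\<lambda>j. y j \<omega>) (\<theta>h \<omega>)
        \<le> fused_lasso_objective \<rho> lam n (\<lambda>j. y j \<omega>) (restrict \<theta> {1..n})"
      unfolding is_arg_min_def by (meson not_le)
    also have "\<dots> = fused_lasso_objective \<rho> lam n (\<lambda>j. y j \<omega>) \<theta>"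
      by (rule fused_lasso_objective_cong) simp
    finally show ?thesis .
  qed
  have upper: "prob {\<omega> \<in> space M. L_plus \<rho> D (\<theta>h \<omega> i - \<theta>s i)
      \<le> - error_bound \<sigma> lam (min (i + 1 - s) (e + 1 - i)) (e + 1 - s) \<delta>}
      \<le> (1 + 24 / (ln 2)\<^sup>2) * \<delta>\<^sup>2"
    using assms(6,9) \<open>{s..e} \<subseteq> {1..n}\<close>
    by (intro right_score_deviation_prob[OF assms(2) indep _ _ y meas min assms(8,3) i assms(14,15)]) auto
  let ?\<rho> = "\<lambda>u. \<rho> (- u)" and ?D = "distr D borel uminus"
  have rd: "right_deriv ?\<rho> x = - left_deriv \<rho> (- x)" for x
    using left_deriv_reflect[OF assms(2), of "- x"] by simp
  have "sets D = sets borel"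
    using assms(6)[OF assms(13)] by (metis sets_distr)
  then have neg_meas: "uminus \<in> D \<rightarrow>\<^sub>M (borel :: real measure)"
    by (subst measurable_cong_sets[OF _ refl]) auto
  have L_reflect: "L_plus ?\<rho> ?D t = - L_minus \<rho> D (- t)" for t
  proof -
    have "(\<lambda>x. right_deriv ?\<rho> (x - t)) \<in> borel_measurable borel"
      by (intro measurable_compose[OF _ borel_measurable_mono[OF right_deriv_mono]]
            convex_on_reflect assms(2)) simp
    then show ?thesis
      unfolding L_plus_def L_minus_def
      by (subst integral_distr[OF neg_meas]) (simp_all add: rd add.commute)
  qed
  have "prob {\<omega> \<in> space M. L_plus ?\<rho> ?D (- \<theta>h \<omega> i - - \<theta>s i)
      \<le> - error_bound \<sigma> lam (min (i + 1 - s) (e + 1 - i)) (e + 1 - s) \<delta>}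
      \<le> (1 + 24 / (ln 2)\<^sup>2) * \<delta>\<^sup>2"
  proof (rule right_score_deviation_prob[where \<epsilon> = "\<lambda>j \<omega>. - \<epsilon> j \<omega>" and y = "\<lambda>j \<omega>. - y j \<omega>" and n = n
        and \<theta>h = "\<lambda>\<omega> j. - \<theta>h \<omega> j", OF convex_on_reflect[OF assms(2)] _ _ _ _ _ _ assms(8,3) i assms(14,15)])
    show "indep_vars (\<lambda>_. borel) (\<lambda>j \<omega>. - \<epsilon> j \<omega>) {s..e}"
      by (rule indep_vars_compose2[OF indep]) simp
    show "distr M borel (\<lambda>\<omega>. - \<epsilon> j \<omega>) = ?D" if "j \<in> {s..e}" for j
    proof -
      have "j \<in> {1..n}" using that \<open>{s..e} \<subseteq> {1..n}\<close> by auto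
      from distr_distr[OF borel_measurable_uminus[OF measurable_ident] \<epsilon>_meas[OF this]] assms(6)[OF this]
      show ?thesis by (simp add: comp_def)
    qed
    show "sub_Gaussian M (\<lambda>\<omega>. right_deriv ?\<rho> (- \<epsilon> j \<omega> - t)) \<sigma>" if "j \<in> {s..e}" for j t
      using sub_Gaussian_uminus[OF assms(10)[of j "- t"]] that \<open>{s..e} \<subseteq> {1..n}\<close>
      by (auto simp: rd add.commute)
    show "- y j \<omega> = - \<theta>s i + - \<epsilon> j \<omega>" if "j \<in> {s..e}" "\<omega> \<in> space M" for j \<omega>
      using y[OF that] by simp
    show "random_variable borel (\<lambda>\<omega>. - \<theta>h \<omega> i)"
      using meas by simp
    show "fused_lasso_objective ?\<rho> lam n (\<lambda>j. - y j \<omega>) (\<lambda>j. - \<theta>h \<omega> j)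
        \<le> fused_lasso_objective ?\<rho> lam n (\<lambda>j. - y j \<omega>) \<theta>" if "\<omega> \<in> space M" for \<omega> \<theta>
      using min[OF that, of "\<lambda>j. - \<theta> j"]
        fused_lasso_objective_reflect[of \<rho> lam n "\<lambda>j. y j \<omega>" "\<theta>h \<omega>"]
        fused_lasso_objective_reflect[of \<rho> lam n "\<lambda>j. y j \<omega>" "\<lambda>j. - \<theta> j"]
      by simp
  qed
  then have lower: "prob {\<omega> \<in> space M. L_minus \<rho> D (\<theta>h \<omega> i - \<theta>s i)
      \<ge> error_bound \<sigma> lam (min (i + 1 - s) (e + 1 - i)) (e + 1 - s) \<delta>}
      \<le> (1 + 24 / (ln 2)\<^sup>2) * \<delta>\<^sup>2"
    unfolding L_reflect by simp
  show ?thesis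
    unfolding dist len using upper lower by blast
qed

end
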